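(* Consider the problem of minimizing $F=f+\psi$ ($f$ not necessarily convex) and the inexact variable-metric block-coordinate descent algorithm (Algorithm A) described in the context. Given any $x^0$ in Algorithm A, let $\{\alpha^k_i\}_{i=1}^N>0$ be the step sizes generated by the line search procedure for $k=0,1,2,\dots$. If $H^k_i\succeq0$ for all $i$ and $k$, then $$\min_{0\le k\le T}\Big|\mathbb E_{i_0,\dots,i_k}\big[\alpha^k_{i_k}Q^k_{i_k}(d^k_{i_k})\big]\Big|\le\frac{F(x^0)-F^*}{\gamma(T+1)}\qquad\text{for all }T\ge0.$$ Moreover, $\mathbb E_{i_0,\dots,i_k}[\alpha^k_{i_k}Q^k_{i_k}(d^k_{i_k})]\to0$ as $k$ approaches infinity.
   Context: Problem. Minimize $F(x)=f(x)+\psi(x)$ over $x\in\mathbb R^n$, where $x=(x_1,\dots,x_N)$ is split into $N$ blocks $x_i\in\mathbb R^{n_i}$, $\sum_i n_i=n$. $U_i\in\mathbb R^{n\times n_i}$ is the column submatrix of the identity with $x_i=U_i^\top x$; $\nabla_if:=U_i^\top\nabla f$. $f$ is blockwise Lipschitz-continuously differentiable: there are constants $L_i>0$ with $\|\nabla_if(x+U_ih)-\nabla_if(x)\|\le L_i\|h\|$ for all $x\in\mathbb R^n$, $h\in\mathbb R^{n_i}$, $i=1,\dots,N$. $\psi(x)=\sum_i\psi_i(x_i)$ with each $\psi_i$ convex, extended-valued, proper and closed. $F$ is bounded below and its set of minimizers is nonempty; $F^*$ is the minimum value. $\|\cdot\|$ is the Euclidean norm. Algorithm A. Given $\beta,\gamma\in(0,1)$,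 $\eta\in[0,1)$, and $x^0\in\mathbb R^n$. At iteration $k=0,1,2,\dots$: pick a probability distribution $p^k_1,\dots,p^k_N>0$, $\sum_ip^k_i=1$, and sample $i_k$ from it. For a block $i$, with a chosen positive-definite matrix $H^k_i\in\mathbb R^{n_i\times n_i}$, let $$Q^k_i(d_i):=\nabla_if(x^k)^\top d_i+\tfrac12d_i^\top H^k_id_i+\psi_i(x^k_i+d_i)-\psi_i(x^k_i),\qquad Q^{k*}_i:=\inf_{d_i}Q^k_i(d_i).$$ For $i=i_k$, compute an $\eta$-approximate minimizer $d^k_i$ of $Q^k_i$, i.e. $\eta(Q^k_i(0)-Q^{k*}_i)\ge Q^k_i(d^k_i)-Q^{k*}_i$. With $\Delta^k_i:=\nabla_if(x^k)^\top d^k_i+\psi_i(x^k_i+d^k_i)-\psi_i(x^k_i)$, let $\alpha^k_i$ be the largest value in $\{1,\beta,\beta^2,\dots\}$ with $F(x^k+\alpha^k_iU_id^k_i)\le F(x^k)+\alpha^k_i\gamma\Delta^k_i$. Set $x^{k+1}=x^k+\alpha^k_{i_k}U_{i_k}d^k_{i_k}$. Conventions. At each iteration, $H^k_i,d^k_i,\alpha^k_i$ are considered for every $i=1,\dots,N$ as the quantities that would result if $i$ were chosen as $i_k$. $\mathbb E_{i_0,\dots,i_k}$ is the expectation over the random block choices $i_0,\dots,i_k$. *)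

theory Defs
  imports "HOL-Analysis.Analysis" "HOL-Probability.Probability_Mass_Function"
begin

(* The splitting x = (x_1, ..., x_N) is given by a map blk from coordinates to blocks.
   R^{n_i} is identified with the coordinate subspace of vectors supported on block i, so that
   U_i becomes the inclusion of block_space blk i and U_i^T becomes block_proj blk i. Likewise, an
   n_i x n_i matrix is given by an n x n matrix of which only the (i,i) diagonal block matters. *)

definition block_space :: "('n \<Rightarrow> 'b) \<Rightarrow> 'b \<Rightarrow> (real ^ 'n::finite) set" where
  "block_space blk i = {v. \<forall>j. blk j \<noteq> i \<longrightarrow> v $ j = 0}"

definition block_proj :: "('n \<Rightarrow> 'b) \<Rightarrow> 'b \<Rightarrow> real ^ 'n \<Rightarrow> real ^ 'n::finite" where
  "block_proj blk i x = (\<chi> j. if blk j = i then x $ j else 0)"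

definition psd_block :: "('n \<Rightarrow> 'b) \<Rightarrow> 'b \<Rightarrow> real ^ 'n ^ 'n::finite \<Rightarrow> bool" where
  "psd_block blk i H \<longleftrightarrow>
     (\<forall>j l. blk j = i \<longrightarrow> blk l = i \<longrightarrow> H $ j $ l = H $ l $ j) \<and>
     (\<forall>v\<in>block_space blk i. 0 \<le> v \<bullet> (H *v v))"

definition gradient :: "(real ^ 'n \<Rightarrow> real) \<Rightarrow> real ^ 'n \<Rightarrow> real ^ 'n::finite" where
  "gradient f x = (THE g. GDERIV f x :> g)"

definition block_gradient ::
    "('n \<Rightarrow> 'b) \<Rightarrow> (real ^ 'n \<Rightarrow> real) \<Rightarrow> 'b \<Rightarrow> real ^ 'n \<Rightarrow> real ^ 'n::finite" where
  "block_gradient blk f i x = block_proj blk i (gradient f x)"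

(* Extended-valued functions on R^{n_i} are functions on the whole space of which only the values
   on block_space blk i are used; convexity and closedness are those of the epigraph. *)

definition epigraph_on :: "'a set \<Rightarrow> ('a \<Rightarrow> ereal) \<Rightarrow> ('a \<times> real) set" where
  "epigraph_on S \<phi> = {(v, r). v \<in> S \<and> \<phi> v \<le> ereal r}"

definition proper_on :: "'a set \<Rightarrow> ('a \<Rightarrow> ereal) \<Rightarrow> bool" where
  "proper_on S \<phi> \<longleftrightarrow> (\<forall>v\<in>S. \<phi> v \<noteq> -\<infinity>) \<and> (\<exists>v\<in>S. \<phi> v \<noteq> \<infinity>)"

definition closed_proper_convex_on :: "'a::real_normed_vector set \<Rightarrow> ('a \<Rightarrow> ereal) \<Rightarrow> bool" where
  "closed_proper_convex_on S \<phi> \<longleftrightarrow>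
     proper_on S \<phi> \<and> convex (epigraph_on S \<phi>) \<and> closed (epigraph_on S \<phi>)"

definition objective ::
    "('n \<Rightarrow> 'b) \<Rightarrow> (real ^ 'n \<Rightarrow> real) \<Rightarrow> ('b::finite \<Rightarrow> real ^ 'n \<Rightarrow> ereal) \<Rightarrow> real ^ 'n::finite \<Rightarrow> ereal" where
  "objective blk f \<psi> x = ereal (f x) + (\<Sum>i\<in>UNIV. \<psi> i (block_proj blk i x))"

definition model ::
    "('n \<Rightarrow> 'b) \<Rightarrow> (real ^ 'n \<Rightarrow> real) \<Rightarrow> ('b \<Rightarrow> real ^ 'n \<Rightarrow> ereal) \<Rightarrow>
     real ^ 'n ^ 'n \<Rightarrow> real ^ 'n \<Rightarrow> 'b \<Rightarrow> real ^ 'n::finite \<Rightarrow> ereal" where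
  "model blk f \<psi> H x i d =
     ereal (block_gradient blk f i x \<bullet> d + 1 / 2 * (d \<bullet> (H *v d)))
       + \<psi> i (block_proj blk i x + d) - \<psi> i (block_proj blk i x)"

definition model_inf ::
    "('n \<Rightarrow> 'b) \<Rightarrow> (real ^ 'n \<Rightarrow> real) \<Rightarrow> ('b \<Rightarrow> real ^ 'n \<Rightarrow> ereal) \<Rightarrow>
     real ^ 'n ^ 'n \<Rightarrow> real ^ 'n::finite \<Rightarrow> 'b \<Rightarrow> ereal" where
  "model_inf blk f \<psi> H x i = (INF d\<in>block_space blk i. model blk f \<psi> H x i d)"

(* The infimum has to be finite for the criterion to be meaningful: with infimum -\<infinity> and \<eta> > 0 the
   inequality would read \<infinity> \<le> \<infinity>. For positive definite H it always is, see
   model_inf_finite_if_pos_def below. *)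

definition approx_minimizer ::
    "('n \<Rightarrow> 'b) \<Rightarrow> (real ^ 'n \<Rightarrow> real) \<Rightarrow> ('b \<Rightarrow> real ^ 'n \<Rightarrow> ereal) \<Rightarrow> real \<Rightarrow>
     real ^ 'n ^ 'n \<Rightarrow> real ^ 'n \<Rightarrow> 'b \<Rightarrow> real ^ 'n::finite \<Rightarrow> bool" where
  "approx_minimizer blk f \<psi> \<eta> H x i d \<longleftrightarrow>
     d \<in> block_space blk i \<and>
     \<bar>model_inf blk f \<psi> H x i\<bar> \<noteq> \<infinity> \<and>
     model blk f \<psi> H x i d - model_inf blk f \<psi> H x i
       \<le> ereal \<eta> * (model blk f \<psi> H x i 0 - model_inf blk f \<psi> H x i)"

definition line_search_decrease ::
    "('n \<Rightarrow> 'b) \<Rightarrow> (real ^ 'n \<Rightarrow> real) \<Rightarrow> ('b \<Rightarrow> real ^ 'n \<Rightarrow> ereal) \<Rightarrow>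
     real ^ 'n \<Rightarrow> 'b \<Rightarrow> real ^ 'n::finite \<Rightarrow> ereal" where
  "line_search_decrease blk f \<psi> x i d =
     ereal (block_gradient blk f i x \<bullet> d)
       + \<psi> i (block_proj blk i x + d) - \<psi> i (block_proj blk i x)"

definition line_search_step ::
    "('n \<Rightarrow> 'b) \<Rightarrow> (real ^ 'n \<Rightarrow> real) \<Rightarrow> ('b::finite \<Rightarrow> real ^ 'n \<Rightarrow> ereal) \<Rightarrow> real \<Rightarrow> real \<Rightarrow>
     real ^ 'n \<Rightarrow> 'b \<Rightarrow> real ^ 'n::finite \<Rightarrow> real \<Rightarrow> bool" where
  "line_search_step blk f \<psi> \<beta> \<gamma> x i d a \<longleftrightarrow>
     (let S = {b. (\<exists>m::nat. b = \<beta> ^ m) \<and>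
                  objective blk f \<psi> (x + b *\<^sub>R d)
                    \<le> objective blk f \<psi> x + ereal (b * \<gamma>) * line_search_decrease blk f \<psi> x i d}
      in a \<in> S \<and> (\<forall>b\<in>S. b \<le> a))"

(* Every choice made at iteration k may depend on the blocks i_0, ..., i_{k-1} drawn so far. Such a
   history is a list with the most recent block first: [i_{k-1}, ..., i_0]. The families p, H, d
   and a are indexed by histories; H, d and a are given for every candidate block i. *)

fun iterate ::
    "real ^ 'n \<Rightarrow> ('b list \<Rightarrow> 'b \<Rightarrow> real) \<Rightarrow> ('b list \<Rightarrow> 'b \<Rightarrow> real ^ 'n) \<Rightarrow> 'b list \<Rightarrow> real ^ 'n::finite" where
  "iterate x0 a d [] = x0"
| "iterate x0 a d (i # h) = iterate x0 a d h + a h i *\<^sub>R d h i"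

fun history_pmf :: "('b list \<Rightarrow> 'b pmf) \<Rightarrow> nat \<Rightarrow> 'b list pmf" where
  "history_pmf p 0 = return_pmf []"
| "history_pmf p (Suc k) = bind_pmf (history_pmf p k) (\<lambda>h. map_pmf (\<lambda>i. i # h) (p h))"

(* E_{i_0,...,i_k} [ a^k_{i_k} Q^k_{i_k}(d^k_{i_k}) ]; the list is [i_k, ..., i_0]. The use of
   real_of_ereal is harmless along runs of the algorithm, see finite_along_runs below. *)

definition expected_model_step ::
    "('n::finite \<Rightarrow> 'b) \<Rightarrow> (real ^ 'n \<Rightarrow> real) \<Rightarrow> ('b \<Rightarrow> real ^ 'n \<Rightarrow> ereal) \<Rightarrow> real ^ 'n \<Rightarrow>
     ('b list \<Rightarrow> 'b pmf) \<Rightarrow> ('b list \<Rightarrow> 'b \<Rightarrow> real ^ 'n ^ 'n) \<Rightarrow> ('b list \<Rightarrow> 'b \<Rightarrow> real ^ 'n) \<Rightarrow>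
     ('b list \<Rightarrow> 'b \<Rightarrow> real) \<Rightarrow> nat \<Rightarrow> real" where
  "expected_model_step blk f \<psi> x0 p H d a k =
     measure_pmf.expectation (history_pmf p (Suc k))
       (\<lambda>is. let i = hd is; h = tl is in
          a h i * real_of_ereal (model blk f \<psi> (H h i) (iterate x0 a d h) i (d h i)))"

lemma block_proj_in_space [simp]: "block_proj blk i x \<in> block_space blk i"
  by (simp add: block_proj_def block_space_def)

lemma subspace_block_space: "subspace (block_space blk i)"
  by (simp add: subspace_def block_space_def)

lemma model_inf_finite_if_pos_def:
  fixes H :: "real ^ 'n ^ 'n::finite"
  assumes cpc: "closed_proper_convex_on (block_space blk i) (\<psi> i)"
    and dom: "\<psi> i (block_proj blk i x) \<noteq> \<infinity>"
    and pd: "\<And>v. v \<in> block_space blk i \<Longrightarrow> v \<noteq> 0 \<Longrightarrow> 0 < v \<bullet> (H *v v)"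
  shows "\<bar>model_inf blk f \<psi> H x i\<bar> \<noteq> \<infinity>"
proof -
  let ?B = "block_space blk i" and ?x = "block_proj blk i x" and ?g = "block_gradient blk f i x"
  have sub: "subspace ?B" by (rule subspace_block_space)
  obtain r where r: "\<psi> i ?x = ereal r"
    using cpc dom block_proj_in_space[of blk i x]
    by (cases "\<psi> i ?x") (auto simp: closed_proper_convex_on_def proper_on_def)
  let ?S = "epigraph_on ?B (\<psi> i)"
  have "(?x, r - 1) \<notin> ?S" by (simp add: epigraph_on_def r)
  then obtain us b where sep: "us \<bullet> (?x, r - 1) < b" "\<forall>z\<in>?S. us \<bullet> z > b"
    using separating_hyperplane_closed_point[of ?S "(?x, r - 1)"] cpc
    unfolding closed_proper_convex_on_def by blast
  obtain u s where us: "us = (u, s)" by (cases us)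
  have "(?x, r) \<in> ?S" by (simp add: epigraph_on_def r)
  then have "u \<bullet> ?x + s * r > b" using sep(2) us by (auto simp: inner_prod_def)
  then have s: "s > 0" using sep(1) us by (auto simp: inner_prod_def algebra_simps)
  have aff: "ereal ((b - u \<bullet> v) / s) \<le> \<psi> i v" if v: "v \<in> ?B" for v
  proof (cases "\<psi> i v")
    case (real t)
    then have "(v, t) \<in> ?S" using v by (simp add: epigraph_on_def)
    then have "u \<bullet> v + s * t > b" using sep(2) us by (auto simp: inner_prod_def)
    then show ?thesis using s real by (simp add: field_simps)
  next
    case MInf
    then show ?thesis using cpc v by (auto simp: closed_proper_convex_on_def proper_on_def)
  qed simp
  obtain m where m: "m > 0" and low: "\<And>d. d \<in> ?B \<Longrightarrow> m * (norm d)\<^sup>2 \<le> d \<bullet> (H *v d)"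
  proof (cases "?B \<inter> sphere 0 1 = {}")
    case True
    have zero: "d = 0" if "d \<in> ?B" for d
    proof (rule ccontr)
      assume "d \<noteq> 0"
      then have "inverse (norm d) *\<^sub>R d \<in> ?B \<inter> sphere 0 1"
        using that sub by (simp add: subspace_scale)
      then show False using True by blast
    qed
    show ?thesis
    proof (rule that[of 1])
      show "1 * (norm d)\<^sup>2 \<le> d \<bullet> (H *v d)" if "d \<in> ?B" for d
        using zero[OF that] by simp
    qed simp
  next
    case False
    have "compact (?B \<inter> sphere 0 1)"
      using closed_subspace[OF sub] by (simp add: closed_Int_compact)
    moreover have "continuous_on (?B \<inter> sphere 0 1) (\<lambda>v. v \<bullet> (H *v v))"
      by (intro continuous_intros linear_continuous_on linear_conv_bounded_linear[THEN iffD1]) simp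
    ultimately obtain w where w: "w \<in> ?B \<inter> sphere 0 1"
      and wmin: "\<forall>v\<in>?B \<inter> sphere 0 1. w \<bullet> (H *v w) \<le> v \<bullet> (H *v v)"
      using continuous_attains_inf[OF _ False] by blast
    show ?thesis
    proof (rule that[of "w \<bullet> (H *v w)"])
      show "0 < w \<bullet> (H *v w)" using w by (intro pd) auto
      fix d assume d: "d \<in> ?B"
      show "w \<bullet> (H *v w) * (norm d)\<^sup>2 \<le> d \<bullet> (H *v d)"
      proof (cases "d = 0")
        case False
        let ?e = "inverse (norm d) *\<^sub>R d"
        have "?e \<in> ?B \<inter> sphere 0 1" using False d sub by (simp add: subspace_scale)
        then have "w \<bullet> (H *v w) \<le> ?e \<bullet> (H *v ?e)" using wmin by blast
        also have "\<dots> = (d \<bullet> (H *v d)) / (norm d)\<^sup>2"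
          by (simp add: matrix_vector_mult_scaleR power2_eq_square field_simps)
        finally show ?thesis using False by (simp add: field_simps)
      qed simp
    qed
  qed
  define w where "w = ?g - (1 / s) *\<^sub>R u"
  define c where "c = (b - u \<bullet> ?x) / s - r - (norm w)\<^sup>2 / (2 * m)"
  have "ereal c \<le> model blk f \<psi> H x i d" if d: "d \<in> ?B" for d
  proof -
    have "?x + d \<in> ?B" using d sub by (simp add: subspace_add)
    note * = aff[OF this]
    have "0 \<le> (norm w - m * norm d)\<^sup>2 / (2 * m)" using m by simp
    also have "\<dots> = (norm w)\<^sup>2 / (2 * m) - norm w * norm d + 1 / 2 * (m * (norm d)\<^sup>2)"
      using m by (simp add: power2_eq_square field_simps)
    finally have "- (norm w)\<^sup>2 / (2 * m) \<le> - (norm w * norm d) + 1 / 2 * (d \<bullet> (H *v d))"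
      using low[OF d] by simp
    also have "\<dots> \<le> w \<bullet> d + 1 / 2 * (d \<bullet> (H *v d))"
      using Cauchy_Schwarz_ineq2[of w d] by simp
    also have "w \<bullet> d = ?g \<bullet> d - (u \<bullet> d) / s" by (simp add: w_def inner_diff_left)
    finally have "c \<le> ?g \<bullet> d + 1 / 2 * (d \<bullet> (H *v d)) + (b - u \<bullet> (?x + d)) / s - r"
      by (simp add: c_def inner_add_right diff_divide_distrib add_divide_distrib)
    then have "ereal c \<le> ereal (?g \<bullet> d + 1 / 2 * (d \<bullet> (H *v d)))
        + ereal ((b - u \<bullet> (?x + d)) / s) - ereal r" by simp
    also have "\<dots> \<le> model blk f \<psi> H x i d"
      unfolding model_def r by (intro ereal_minus_mono add_mono * order_refl)
    finally show ?thesis .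
  qed
  then have "ereal c \<le> model_inf blk f \<psi> H x i"
    unfolding model_inf_def by (intro INF_greatest) auto
  moreover have "model_inf blk f \<psi> H x i \<le> model blk f \<psi> H x i 0"
    unfolding model_inf_def by (intro INF_lower subspace_0[OF sub])
  moreover have "model blk f \<psi> H x i 0 = 0" by (simp add: model_def r)
  ultimately show ?thesis by auto
qed

lemma approx_minimizer_finite:
  assumes proper: "proper_on (block_space blk i) (\<psi> i)"
    and dom: "\<psi> i (block_proj blk i x) \<noteq> \<infinity>"
    and am: "approx_minimizer blk f \<psi> \<eta> H x i d"
  shows "\<bar>model blk f \<psi> H x i d\<bar> \<noteq> \<infinity>"
    and "\<bar>line_search_decrease blk f \<psi> x i d\<bar> \<noteq> \<infinity>"
proof -
  let ?B = "block_space blk i" and ?x = "block_proj blk i x"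
  obtain r where r: "\<psi> i ?x = ereal r"
    using proper dom block_proj_in_space[of blk i x] by (cases "\<psi> i ?x") (auto simp: proper_on_def)
  obtain q where q: "model_inf blk f \<psi> H x i = ereal q"
    using am by (cases "model_inf blk f \<psi> H x i") (auto simp: approx_minimizer_def)
  have m0: "model blk f \<psi> H x i 0 = 0" by (simp add: model_def r)
  have dB: "?x + d \<in> ?B"
    using am by (intro subspace_add subspace_block_space) (auto simp: approx_minimizer_def)
  have fin: "model blk f \<psi> H x i d \<noteq> \<infinity>"
    using am by (auto simp: approx_minimizer_def q m0)
  have "\<bar>\<psi> i (?x + d)\<bar> \<noteq> \<infinity>"
    using fin dB proper by (cases "\<psi> i (?x + d)") (auto simp: model_def r proper_on_def)
  then show "\<bar>model blk f \<psi> H x i d\<bar> \<noteq> \<infinity>" "\<bar>line_search_decrease blk f \<psi> x i d\<bar> \<noteq> \<infinity>"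
    by (cases "\<psi> i (?x + d)"; simp add: model_def line_search_decrease_def r)+
qed

lemma finite_along_runs:
  assumes proper: "\<And>i. proper_on (block_space blk i) (\<psi> i)"
    and dom: "objective blk f \<psi> x0 < \<infinity>"
    and am: "\<And>h i. approx_minimizer blk f \<psi> \<eta> (H h i) (iterate x0 a d h) i (d h i)"
    and ls: "\<And>h i. line_search_step blk f \<psi> \<beta> \<gamma> (iterate x0 a d h) i (d h i) (a h i)"
  shows "objective blk f \<psi> (iterate x0 a d h) < \<infinity>"
    and "\<bar>model blk f \<psi> (H h i) (iterate x0 a d h) i (d h i)\<bar> \<noteq> \<infinity>"
proof -
  have dom_block: "\<psi> i (block_proj blk i x) \<noteq> \<infinity>" if "objective blk f \<psi> x < \<infinity>" for x i
    using that by (auto simp: objective_def sum_Pinfty)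
  show obj: "objective blk f \<psi> (iterate x0 a d h) < \<infinity>"
  proof (induction h)
    case (Cons i h)
    obtain D where D: "line_search_decrease blk f \<psi> (iterate x0 a d h) i (d h i) = ereal D"
      using approx_minimizer_finite(2)[where \<psi> = \<psi>, OF proper dom_block[OF Cons] am[of h i]]
      by (cases "line_search_decrease blk f \<psi> (iterate x0 a d h) i (d h i)") simp_all
    have "objective blk f \<psi> (iterate x0 a d (i # h))
        \<le> objective blk f \<psi> (iterate x0 a d h) + ereal (a h i * \<gamma>) * ereal D"
      using ls[of h i] unfolding line_search_step_def Let_def D by simp
    also have "\<dots> < \<infinity>" using Cons by simp
    finally show ?case .
  qed (use dom in simp)
  show "\<bar>model blk f \<psi> (H h i) (iterate x0 a d h) i (d h i)\<bar> \<noteq> \<infinity>"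
    using approx_minimizer_finite(1)[where \<psi> = \<psi>, OF proper dom_block[OF obj] am[of h i]] .
qed

end

theory Submission
  imports Defs
begin

text \<open>
  Positive semidefiniteness of the scaling matrices gives \<open>\<Delta> \<le> Q(d)\<close>, and an \<open>\<eta>\<close>-approximate minimizer
  satisfies \<open>Q(d) \<le> (1 - \<eta>) Q\<^sup>* \<le> 0\<close>, because \<open>Q(0) = 0\<close>. The line search therefore forces \<open>F\<close> to drop
  by at least \<open>\<gamma> \<alpha> \<bar>Q(d)\<bar>\<close> whichever block is drawn (\<open>objective_decrease\<close>).
  Since the law of the history after \<open>k\<close> draws is the marginal of its law after \<open>k + 1\<close> draws
  (\<open>map_tl_history_pmf\<close>), the expected drops telescope, so that
  \<open>\<gamma> (\<bar>E\<^sub>0\<bar> + \<dots> + \<bar>E\<^sub>T\<bar>)\<close> is at most \<open>F(x\<^sup>0)\<close> minus the expected value of \<open>F(x\<^bsup>T+1\<^esup>)\<close>, hence at most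
  \<open>F(x\<^sup>0) - F\<^sup>*\<close>. The smallest term is at most the average, and the terms of a convergent series
  tend to zero (\<open>decrease_imp_Min_le_and_null\<close>).

  All expectations are finite sums, as there are finitely many blocks; the only care needed is with
  the extended values of \<open>F\<close> and \<open>Q\<close>, which are finite along every run that starts in the domain of \<open>F\<close>.
\<close>

section \<open>Descent in one step\<close>

lemma model_zero:
  assumes "\<bar>\<psi> i (block_proj blk i x)\<bar> \<noteq> \<infinity>"
  shows "model blk f \<psi> H x i 0 = 0"
  using assms by (cases "\<psi> i (block_proj blk i x)") (auto simp: model_def)

text \<open>The infimum of the model is at most its value \<open>0\<close> at the origin, and closing at least a fraction
  \<open>1 - \<eta> \<ge> 0\<close> of the gap to that infimum cannot lead to a positive value.\<close>

lemma approx_minimizer_model_nonpos: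
  assumes dom: "\<bar>\<psi> i (block_proj blk i x)\<bar> \<noteq> \<infinity>"
    and am: "approx_minimizer blk f \<psi> \<eta> H x i d"
    and eta: "\<eta> \<le> 1"
  shows "model blk f \<psi> H x i d \<le> 0"
proof -
  have m0: "model blk f \<psi> H x i 0 = 0"
    by (rule model_zero[where \<psi> = \<psi>, OF dom])
  obtain q where q: "model_inf blk f \<psi> H x i = ereal q"
    using am by (cases "model_inf blk f \<psi> H x i") (auto simp: approx_minimizer_def)
  have "model_inf blk f \<psi> H x i \<le> model blk f \<psi> H x i 0"
    unfolding model_inf_def by (intro INF_lower subspace_0[OF subspace_block_space])
  then have "q \<le> 0"
    by (simp add: q m0)
  then have "(1 - \<eta>) * q \<le> 0"
    using eta by (simp add: mult_nonneg_nonpos)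
  moreover have "model blk f \<psi> H x i d - ereal q \<le> ereal \<eta> * (0 - ereal q)"
    using am by (simp add: approx_minimizer_def q m0)
  ultimately show ?thesis
    by (cases "model blk f \<psi> H x i d") (auto simp: algebra_simps)
qed

text \<open>The two quantities differ by the quadratic term of the model.\<close>

lemma line_search_decrease_le_model:
  assumes "psd_block blk i H" and "d \<in> block_space blk i"
  shows "line_search_decrease blk f \<psi> x i d \<le> model blk f \<psi> H x i d"
  using assms unfolding line_search_decrease_def model_def psd_block_def
  by (intro ereal_minus_mono add_right_mono) auto

lemma line_search_step_nonneg:
  assumes "line_search_step blk f \<psi> \<beta> \<gamma> x i d a" and "0 \<le> \<beta>"
  shows "0 \<le> a"
  using assms by (auto simp: line_search_step_def Let_def)

lemma objective_decrease:
  assumes proper: "\<And>i. proper_on (block_space blk i) (\<psi> i)"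
    and fin: "\<bar>objective blk f \<psi> x\<bar> \<noteq> \<infinity>" "\<bar>objective blk f \<psi> (x + a *\<^sub>R d)\<bar> \<noteq> \<infinity>"
    and psd: "psd_block blk i H"
    and am: "approx_minimizer blk f \<psi> \<eta> H x i d" and eta: "\<eta> \<le> 1"
    and ls: "line_search_step blk f \<psi> \<beta> \<gamma> x i d a" and beta: "0 \<le> \<beta>" and gamma: "0 \<le> \<gamma>"
  shows "\<gamma> * \<bar>a * real_of_ereal (model blk f \<psi> H x i d)\<bar>
           \<le> real_of_ereal (objective blk f \<psi> x) - real_of_ereal (objective blk f \<psi> (x + a *\<^sub>R d))"
proof -
  have "objective blk f \<psi> x \<noteq> \<infinity>"
    using fin(1) by auto
  then have "\<psi> i (block_proj blk i x) \<noteq> \<infinity>"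
    by (auto simp: objective_def sum_Pinfty)
  moreover from this have dom: "\<bar>\<psi> i (block_proj blk i x)\<bar> \<noteq> \<infinity>"
    using proper[of i] block_proj_in_space[of blk i x] by (auto simp: proper_on_def)
  ultimately obtain Q D where
    Q: "model blk f \<psi> H x i d = ereal Q" and D: "line_search_decrease blk f \<psi> x i d = ereal D"
    using approx_minimizer_finite[where \<psi> = \<psi>, OF proper _ am] by fastforce
  obtain u v where
    u: "objective blk f \<psi> x = ereal u" and v: "objective blk f \<psi> (x + a *\<^sub>R d) = ereal v"
    using fin by fastforce
  have a: "0 \<le> a"
    by (rule line_search_step_nonneg[OF ls beta])
  have "Q \<le> 0"
    using approx_minimizer_model_nonpos[where \<psi> = \<psi>, OF dom am eta] by (simp add: Q)
  then have "\<bar>a * Q\<bar> = - (a * Q)"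
    using a by (simp add: mult_nonneg_nonpos abs_of_nonpos)
  moreover have "D \<le> Q"
    using line_search_decrease_le_model[OF psd, of d f \<psi> x] am
    by (simp add: approx_minimizer_def Q D)
  then have "(a * \<gamma>) * D \<le> (a * \<gamma>) * Q"
    using a gamma by (intro mult_left_mono) auto
  moreover have "v \<le> u + a * \<gamma> * D"
    using ls by (simp add: line_search_step_def Let_def u v D)
  ultimately show "\<gamma> * \<bar>a * real_of_ereal (model blk f \<psi> H x i d)\<bar>
      \<le> real_of_ereal (objective blk f \<psi> x) - real_of_ereal (objective blk f \<psi> (x + a *\<^sub>R d))"
    unfolding Q u v by (simp add: algebra_simps)
qed

section \<open>The law of the history\<close>

lemma finite_set_history_pmf:
  fixes p :: "'b::finite list \<Rightarrow> 'b pmf"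
  shows "finite (set_pmf (history_pmf p k))"
  by (induction k) auto

lemma integrable_history_pmf:
  fixes p :: "'b::finite list \<Rightarrow> 'b pmf" and g :: "'b list \<Rightarrow> real"
  shows "integrable (measure_pmf (history_pmf p k)) g"
  by (rule integrable_measure_pmf_finite[OF finite_set_history_pmf])

lemma set_history_pmf_Suc_not_Nil:
  assumes "is \<in> set_pmf (history_pmf p (Suc k))"
  shows "is \<noteq> []"
  using assms by auto

text \<open>This consistency of the laws is what makes the expected objective values telescope.\<close>

lemma map_tl_history_pmf: "map_pmf tl (history_pmf p (Suc k)) = history_pmf p k"
proof -
  have "map_pmf tl (history_pmf p (Suc k)) = bind_pmf (history_pmf p k) return_pmf"
    by (simp add: map_bind_pmf pmf.map_comp o_def)
  then show ?thesis
    by (simp add: bind_return_pmf')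
qed

lemma expectation_tl_history_pmf:
  fixes g :: "'b list \<Rightarrow> real"
  shows "measure_pmf.expectation (history_pmf p (Suc k)) (\<lambda>is. g (tl is))
           = measure_pmf.expectation (history_pmf p k) g"
  unfolding map_tl_history_pmf[of p k, symmetric] integral_map_pmf ..

section \<open>Telescoping\<close>

lemma decrease_imp_Min_le_and_null:
  fixes u :: "nat \<Rightarrow> real" and \<Phi> :: "nat \<Rightarrow> real"
  assumes gamma: "0 < \<gamma>"
    and dec: "\<And>k. \<gamma> * \<bar>u k\<bar> \<le> \<Phi> k - \<Phi> (Suc k)"
    and low: "\<And>k. m \<le> \<Phi> k"
  shows "(MIN k\<in>{0..T}. \<bar>u k\<bar>) \<le> (\<Phi> 0 - m) / (\<gamma> * (real T + 1))"
    and "u \<longlonglongrightarrow> 0"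
proof -
  have sum_le: "(\<Sum>k<n. \<bar>u k\<bar>) \<le> (\<Phi> 0 - m) / \<gamma>" for n
  proof -
    have "\<gamma> * (\<Sum>k<n. \<bar>u k\<bar>) \<le> (\<Sum>k<n. \<Phi> k - \<Phi> (Suc k))"
      unfolding sum_distrib_left by (intro sum_mono dec)
    also have "\<dots> = \<Phi> 0 - \<Phi> n"
      by (rule sum_lessThan_telescope')
    also have "\<dots> \<le> \<Phi> 0 - m"
      using low[of n] by simp
    finally show ?thesis
      using gamma by (simp add: field_simps)
  qed
  let ?M = "MIN k\<in>{0..T}. \<bar>u k\<bar>"
  have "(\<Sum>k<Suc T. ?M) \<le> (\<Sum>k<Suc T. \<bar>u k\<bar>)"
    by (intro sum_mono Min_le) auto
  then have "(real T + 1) * ?M \<le> (\<Phi> 0 - m) / \<gamma>"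
    using sum_le[of "Suc T"] by (simp add: algebra_simps)
  then show "?M \<le> (\<Phi> 0 - m) / (\<gamma> * (real T + 1))"
    using gamma by (simp add: pos_le_divide_eq mult.commute mult.left_commute)
  have "summable (\<lambda>k. \<bar>u k\<bar>)"
    by (rule summableI_nonneg_bounded[OF _ sum_le]) simp
  then show "u \<longlonglongrightarrow> 0"
    using summable_LIMSEQ_zero tendsto_rabs_zero_iff by blast
qed

theorem theorem4:
  fixes blk :: "'n::finite \<Rightarrow> 'b::finite"
    and f :: "real ^ 'n \<Rightarrow> real"
    and \<psi> :: "'b \<Rightarrow> real ^ 'n \<Rightarrow> ereal"
    and L :: "'b \<Rightarrow> real"
    and \<beta> \<gamma> \<eta> :: real
    and x0 :: "real ^ 'n"
    and p :: "'b list \<Rightarrow> 'b pmf"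
    and H :: "'b list \<Rightarrow> 'b \<Rightarrow> real ^ 'n ^ 'n"
    and d :: "'b list \<Rightarrow> 'b \<Rightarrow> real ^ 'n"
    and \<alpha> :: "'b list \<Rightarrow> 'b \<Rightarrow> real"
  defines "F \<equiv> objective blk f \<psi>"
  defines "Fstar \<equiv> (INF x. F x)"
  defines "E \<equiv> expected_model_step blk f \<psi> x0 p H d \<alpha>"
  assumes f_diff: "\<And>x. f differentiable (at x)"
    and L_pos: "\<And>i. 0 < L i"
    and f_lipschitz: "\<And>i x h. h \<in> block_space blk i \<Longrightarrow>
          norm (block_gradient blk f i (x + h) - block_gradient blk f i x) \<le> L i * norm h"
    and psi: "\<And>i. closed_proper_convex_on (block_space blk i) (\<psi> i)"
    and F_bounded_below: "\<exists>m::real. \<forall>x. ereal m \<le> F x"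
    and F_minimizer: "\<exists>xs. \<forall>x. F xs \<le> F x"
    and beta: "0 < \<beta>" "\<beta> < 1"
    and gamma: "0 < \<gamma>" "\<gamma> < 1"
    and eta: "0 \<le> \<eta>" "\<eta> < 1"
    and x0: "F x0 < \<infinity>"
    and p_pos: "\<And>h i. 0 < pmf (p h) i"
    and H_psd: "\<And>h i. psd_block blk i (H h i)"
    and d_approx: "\<And>h i. approx_minimizer blk f \<psi> \<eta> (H h i) (iterate x0 \<alpha> d h) i (d h i)"
    and step_size: "\<And>h i. line_search_step blk f \<psi> \<beta> \<gamma> (iterate x0 \<alpha> d h) i (d h i) (\<alpha> h i)"
  shows "(\<forall>T. ereal (MIN k\<in>{0..T}. \<bar>E k\<bar>) \<le> (F x0 - Fstar) / ereal (\<gamma> * (real T + 1))) \<and>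
         E \<longlonglongrightarrow> 0"
proof -
  define \<phi> where "\<phi> h = real_of_ereal (F (iterate x0 \<alpha> d h))" for h
  define \<Phi> where "\<Phi> k = measure_pmf.expectation (history_pmf p k) \<phi>" for k
  have proper: "proper_on (block_space blk i) (\<psi> i)" for i
    using psi by (simp add: closed_proper_convex_on_def)
  have F_fin: "\<bar>F x\<bar> \<noteq> \<infinity>" if "F x < \<infinity>" for x
    using that by (cases "F x") (use F_bounded_below in \<open>auto dest: spec[of _ x]\<close>)
  have "F (iterate x0 \<alpha> d h) < \<infinity>" for h
    using finite_along_runs(1)[where \<psi> = \<psi> and ?x0.0 = x0, OF proper _ d_approx step_size] x0
    by (simp add: F_def)
  then have fin: "\<bar>F (iterate x0 \<alpha> d h)\<bar> \<noteq> \<infinity>" for h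
    by (rule F_fin)
  then have \<phi>: "F (iterate x0 \<alpha> d h) = ereal (\<phi> h)" for h
    by (simp add: \<phi>_def ereal_real')
  have Fstar_le: "Fstar \<le> F x" for x
    unfolding Fstar_def by (intro INF_lower) simp
  obtain m where m: "Fstar = ereal m"
  proof (cases Fstar)
    case PInf
    then show ?thesis using Fstar_le[of x0] x0 by simp
  next
    case MInf
    obtain l where "\<And>x. ereal l \<le> F x" using F_bounded_below by blast
    then have "ereal l \<le> Fstar" unfolding Fstar_def by (intro INF_greatest)
    then show ?thesis using MInf by simp
  qed (rule that)

  define w where "w is = \<alpha> (tl is) (hd is)
      * real_of_ereal (model blk f \<psi> (H (tl is) (hd is)) (iterate x0 \<alpha> d (tl is)) (hd is) (d (tl is) (hd is)))"
    for "is"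
  have E: "E k = measure_pmf.expectation (history_pmf p (Suc k)) w" for k
    by (simp add: E_def expected_model_step_def w_def[abs_def] Let_def)
  have step: "\<gamma> * \<bar>w is\<bar> \<le> \<phi> (tl is) - \<phi> is" if ne: "is \<noteq> []" for "is"
  proof -
    obtain i h where ih: "is = i # h" using ne by (cases "is") auto
    have fin': "\<bar>objective blk f \<psi> (iterate x0 \<alpha> d h)\<bar> \<noteq> \<infinity>"
      "\<bar>objective blk f \<psi> (iterate x0 \<alpha> d h + \<alpha> h i *\<^sub>R d h i)\<bar> \<noteq> \<infinity>"
      using fin[of h] fin[of "i # h"] by (simp_all add: F_def)
    note * = objective_decrease[where \<psi> = \<psi>, OF proper fin' H_psd d_approx _ step_size]
    show "\<gamma> * \<bar>w is\<bar> \<le> \<phi> (tl is) - \<phi> is"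
      using * eta beta gamma by (simp_all add: ih w_def \<phi>_def F_def)
  qed
  have dec: "\<gamma> * \<bar>E k\<bar> \<le> \<Phi> k - \<Phi> (Suc k)" for k
  proof -
    let ?P = "history_pmf p (Suc k)"
    have "\<gamma> * \<bar>E k\<bar> \<le> \<gamma> * measure_pmf.expectation ?P (\<lambda>is. \<bar>w is\<bar>)"
      using gamma unfolding E by (intro mult_left_mono integral_abs_bound) auto
    also have "\<dots> = measure_pmf.expectation ?P (\<lambda>is. \<gamma> * \<bar>w is\<bar>)"
      by simp
    also have "\<dots> \<le> measure_pmf.expectation ?P (\<lambda>is. \<phi> (tl is) - \<phi> is)"
      by (intro integral_mono_AE integrable_history_pmf AE_pmfI step
          set_history_pmf_Suc_not_Nil)
    also have "\<dots> = \<Phi> k - \<Phi> (Suc k)"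
      using expectation_tl_history_pmf[of p k \<phi>]
      by (simp add: Bochner_Integration.integral_diff integrable_history_pmf \<Phi>_def
          del: history_pmf.simps)
    finally show ?thesis .
  qed
  have "m \<le> \<phi> h" for h
    using Fstar_le[of "iterate x0 \<alpha> d h"] by (simp add: m \<phi>)
  then have low: "m \<le> \<Phi> k" for k
    unfolding \<Phi>_def by (intro measure_pmf.integral_ge_const integrable_history_pmf AE_I2)
  have "F x0 = ereal (\<Phi> 0)"
    using \<phi>[of "[]"] by (simp add: \<Phi>_def)
  moreover have "ereal (\<gamma> * (real T + 1)) \<noteq> 0" for T
    using gamma by simp
  ultimately have bound: "(F x0 - Fstar) / ereal (\<gamma> * (real T + 1))
      = ereal ((\<Phi> 0 - m) / (\<gamma> * (real T + 1)))" for T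
    by (simp add: m)
  show ?thesis
    unfolding bound ereal_less_eq
    using decrease_imp_Min_le_and_null[where u = E and \<Phi> = \<Phi>, OF gamma(1) dec low] by blast
qed

end
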